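(* A unipotent map $G\colon\mathbb{R}^2\to\mathbb{R}^2$ of class $C^1$ has no periodic points.
   Context: A differentiable map $G\colon\mathbb{R}^2\to\mathbb{R}^2$ is called unipotent if its spectrum $\mathrm{Spc}(G)=\{\text{eigenvalues of } DG_z : z\in\mathbb{R}^2\}\subset\mathbb{C}$ is the set $\{1\}$. For an integer $m>0$, $G^m$ denotes the $m$-fold composition of $G$ with itself. A point $(x,y)\in\mathbb{R}^2$ is called a periodic point of $G$ if there is an integer $p>1$ such that $G^p(x,y)=(x,y)$ but $G^m(x,y)\neq(x,y)$ for all $1\leq m\leq p-1$ (so fixed points of $G$ are not periodic points in this sense). *)

theory Defs
  imports "HOL-Analysis.Analysis"
begin

definition C1_map :: "(real ^ 'n \<Rightarrow> real ^ 'm) \<Rightarrow> bool" where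
  "C1_map G \<longleftrightarrow> (\<forall>z. G differentiable (at z)) \<and> continuous_on UNIV (\<lambda>z. jacobian G (at z))"

definition eigenvalues :: "complex ^ 'n ^ 'n \<Rightarrow> complex set" where
  "eigenvalues A = {c. \<exists>v. v \<noteq> 0 \<and> A *v v = c *s v}"

(* The real Jacobian is complexified, so that non-real eigenvalues belong to Spc as well. *)
definition Spc :: "(real ^ 'n \<Rightarrow> real ^ 'n) \<Rightarrow> complex set" where
  "Spc G = (\<Union>z. eigenvalues (map_matrix complex_of_real (jacobian G (at z))))"

definition unipotent :: "(real ^ 'n \<Rightarrow> real ^ 'n) \<Rightarrow> bool" where
  "unipotent G \<longleftrightarrow> (\<forall>z. G differentiable (at z)) \<and> Spc G = {1}"

(* Fixed points are deliberately not periodic points: the period p is at least 2. *)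
definition periodic_point :: "('a \<Rightarrow> 'a) \<Rightarrow> 'a \<Rightarrow> bool" where
  "periodic_point G z \<longleftrightarrow>
     (\<exists>p::nat. p > 1 \<and> (G ^^ p) z = z \<and> (\<forall>m\<in>{1..p - 1}. (G ^^ m) z \<noteq> z))"

end

theory Submission
  imports Defs
begin

text \<open>
  Write \<open>G = id + H\<close>. Unipotence says that \<open>DH\<close> is nilpotent everywhere: it has trace and
  determinant zero. The vanishing trace means that \<open>(u, v) = (- H\<^sub>2, H\<^sub>1)\<close> has a symmetric
  derivative, as the gradient of a function \<open>F\<close> of class \<open>C\<^sup>2\<close> has; the vanishing determinant then
  says that the Hessian of \<open>F\<close> is degenerate, so that the graph of \<open>F\<close> is a complete flat surface.
  By the theorem of Hartman and Nirenberg such a surface is a cylinder: some direction \<open>w\<close> lies in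
  the kernel of the Hessian at every point. This is \<open>common_kernel\<close>.

  The cylinder theorem has three steps. Near a point where the Hessian does not vanish, the level
  curve of the gradient is a straight segment along the kernel, and the reciprocal of a diagonal
  entry of the Hessian is an affine function on it (\<open>local_line\<close>). An affine function stays finite
  along the whole line, so the Hessian cannot vanish anywhere on the line, and the segment extends
  to a complete line with constant kernel (\<open>whole_line\<close>, \<open>kernel_line\<close>). Two such lines with
  different directions would cross, and at the crossing point the Hessian would have a
  two-dimensional kernel although it does not vanish there; hence all of them are parallel.

  For \<open>G\<close> this means that \<open>H\<close> is constant along a direction \<open>d\<close> and that the component of \<open>H\<close>
  transversal to \<open>d\<close> is a constant \<open>k\<close> (\<open>unipotent_imp_shear\<close>). Along an orbit, a linear form
  vanishing on \<open>d\<close> grows by \<open>k\<close> in each step. A periodic orbit forces \<open>k = 0\<close>; then each step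
  moves the point by a multiple of \<open>d\<close> and so leaves \<open>H\<close> unchanged. The orbit is therefore an
  arithmetic progression, which returns to its start only if it is constant.
\<close>

section \<open>Gradient maps of the plane with degenerate Hessian\<close>

text \<open>
  The entries \<open>a\<close>, \<open>b\<close>, \<open>c\<close> stand for \<open>F\<^sub>x\<^sub>x\<close>, \<open>F\<^sub>x\<^sub>y\<close>, \<open>F\<^sub>y\<^sub>y\<close>, and \<open>u\<close>, \<open>v\<close> for \<open>F\<^sub>x\<close>, \<open>F\<^sub>y\<close>, with
  the symmetry of the Hessian expressed by the shared entry \<open>b\<close>.
\<close>

locale degenerate_hessian =
  fixes u v a b c :: "real \<times> real \<Rightarrow> real"
  assumes deriv_u: "\<And>z. (u has_derivative (\<lambda>w. a z * fst w + b z * snd w)) (at z)"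
    and deriv_v: "\<And>z. (v has_derivative (\<lambda>w. b z * fst w + c z * snd w)) (at z)"
    and cont_a: "continuous_on UNIV a"
    and cont_b: "continuous_on UNIV b"
    and cont_c: "continuous_on UNIV c"
    and degenerate: "\<And>z. a z * c z = b z ^ 2"
begin

definition in_kernel :: "real \<times> real \<Rightarrow> real \<times> real \<Rightarrow> bool" where
  "in_kernel z w \<longleftrightarrow> a z * fst w + b z * snd w = 0 \<and> b z * fst w + c z * snd w = 0"

text \<open>
  Where \<open>F\<^sub>x\<^sub>x\<close> does not vanish, \<open>(x, y) \<mapsto> (u (x, y), y)\<close> is a chart that straightens the level
  curves of \<open>u\<close> into vertical segments; its inverse is differentiable with the derivative that
  solving \<open>a dx + b dy = du\<close> for \<open>dx\<close> gives.
\<close>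

lemma chart_inverse:
  assumes "a p \<noteq> 0"
  shows "\<exists>V g. open V \<and> (u p, snd p) \<in> V \<and> g (u p, snd p) = p \<and>
    (\<forall>y\<in>V. u (g y) = fst y \<and> snd (g y) = snd y \<and> a (g y) \<noteq> 0 \<and>
      (g has_derivative (\<lambda>w. ((fst w - b (g y) * snd w) / a (g y), snd w))) (at y))"
proof -
  define \<Psi> where "\<Psi> = (\<lambda>z. (u z, snd z))"
  define E1 where "E1 = Blinfun (\<lambda>w::real \<times> real. (fst w, 0::real))"
  define E2 where "E2 = Blinfun (\<lambda>w::real \<times> real. (snd w, 0::real))"
  define E3 where "E3 = Blinfun (\<lambda>w::real \<times> real. (0::real, snd w))"
  define D where "D z = a z *\<^sub>R E1 + b z *\<^sub>R E2 + E3" for z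
  define L where "L = (1 / a p) *\<^sub>R (E1 - b p *\<^sub>R E2) + E3"
  have E: "blinfun_apply E1 = (\<lambda>w. (fst w, 0))" "blinfun_apply E2 = (\<lambda>w. (snd w, 0))"
      "blinfun_apply E3 = (\<lambda>w. (0, snd w))"
    unfolding E1_def E2_def E3_def
    by (auto intro!: bounded_linear_Blinfun_apply bounded_linear_Pair bounded_linear_fst bounded_linear_snd)
  have D: "blinfun_apply (D z) = (\<lambda>w. (a z * fst w + b z * snd w, snd w))" for z
    unfolding D_def by (rule ext) (simp add: E blinfun.add_left blinfun.scaleR_left)
  have der: "(\<Psi> has_derivative blinfun_apply (D z)) (at z)" for z
    unfolding \<Psi>_def D by (auto intro!: derivative_eq_intros deriv_u)
  \<comment> \<open>Expanding the derivative in three fixed operators reduces its continuity in the operator norm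
    to that of the coefficients.\<close>
  have "continuous_on UNIV D"
    unfolding D_def by (intro continuous_intros cont_a cont_b)
  moreover have "L o\<^sub>L D p = id_blinfun"
    using assms
    by (intro blinfun_eqI)
      (simp add: L_def D E blinfun.add_left blinfun.diff_left blinfun.scaleR_left prod_eq_iff)
  ultimately obtain U' V g g' where *: "open U'" "p \<in> U'" "open V" "\<Psi> p \<in> V"
      "homeomorphism U' V \<Psi> g"
      "\<And>y. y \<in> V \<Longrightarrow> (g has_derivative (g' y)) (at y)"
      "\<And>y. y \<in> V \<Longrightarrow> g' y = inv (blinfun_apply (D (g y)))"
      "\<And>y. y \<in> V \<Longrightarrow> bij (blinfun_apply (D (g y)))"
    using inverse_function_theorem[OF open_UNIV der _ UNIV_I] by metis
  show ?thesis
  proof (intro exI[of _ V] exI[of _ g] conjI ballI)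
    show "open V" "(u p, snd p) \<in> V" "g (u p, snd p) = p"
      using * by (auto simp: \<Psi>_def homeomorphism_def)
    have inv: "u (g y) = fst y \<and> snd (g y) = snd y \<and> a (g y) \<noteq> 0" if "y \<in> V" for y
    proof -
      have "\<Psi> (g y) = y"
        using * that by (auto simp: homeomorphism_def)
      moreover have "a (g y) \<noteq> 0"
      proof
        assume "a (g y) = 0"
        then have "D (g y) (1, 0) = D (g y) (0, 0)" by (simp add: D)
        then show False
          using *(8)[OF that] by (auto simp: bij_def dest: injD)
      qed
      ultimately show ?thesis by (simp add: \<Psi>_def prod_eq_iff)
    qed
    then show "u (g y) = fst y" "snd (g y) = snd y" "a (g y) \<noteq> 0" if "y \<in> V" for y
      using that by blast+
    show "(g has_derivative (\<lambda>w. ((fst w - b (g y) * snd w) / a (g y), snd w))) (at y)"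
      if "y \<in> V" for y
    proof -
      have "g' y = (\<lambda>w. ((fst w - b (g y) * snd w) / a (g y), snd w))"
        unfolding *(7)[OF that]
      proof (rule inv_equality)
      qed (use inv[OF that] in \<open>auto simp: D\<close>)
      then show ?thesis using *(6)[OF that] by simp
    qed
  qed
qed

text \<open>
  Let \<open>(X (t, y), y)\<close> be the inverse chart. Because the Hessian is degenerate, \<open>v\<close> expressed in the
  chart does not depend on \<open>y\<close>; say it is \<open>W t\<close>. Its derivative in \<open>t\<close> is \<open>b / a\<close>, which by the
  symmetry of the Hessian is also the derivative of \<open>- X\<close> in \<open>y\<close>. So the slope of each level
  curve is constant and \<open>X (t, y)\<close> is affine in \<open>y\<close>. Consequently the derivative of \<open>X\<close> in \<open>t\<close>,
  which is \<open>1 / a\<close>, is affine in \<open>y\<close> too.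
\<close>

lemma local_line:
  assumes "a p \<noteq> 0"
  defines "m \<equiv> b p / a p"
  obtains \<delta> A B where "\<delta> > 0"
    "\<And>s. \<bar>s\<bar> < \<delta> \<Longrightarrow>
       a (p + s *\<^sub>R (- m, 1)) * (A + B * s) = 1 \<and>
       b (p + s *\<^sub>R (- m, 1)) = m * a (p + s *\<^sub>R (- m, 1))"
proof -
  obtain V g where V: "open V" "(u p, snd p) \<in> V" "g (u p, snd p) = p"
    and chart: "\<forall>y\<in>V. u (g y) = fst y \<and> snd (g y) = snd y \<and> a (g y) \<noteq> 0 \<and>
      (g has_derivative (\<lambda>w. ((fst w - b (g y) * snd w) / a (g y), snd w))) (at y)"
    using chart_inverse[OF assms(1)] by (elim exE conjE)
  have inv: "u (g y) = fst y \<and> snd (g y) = snd y \<and> a (g y) \<noteq> 0"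
    and der: "(g has_derivative (\<lambda>w. ((fst w - b (g y) * snd w) / a (g y), snd w))) (at y)"
    if "y \<in> V" for y
    using chart that by blast+
  obtain r where r: "r > 0" "ball (u p, snd p) r \<subseteq> V"
    using V(1,2) open_contains_ball by blast
  define e where "e = r / 2"
  have e: "e > 0" using r by (simp add: e_def)
  define y0 where "y0 = snd p"
  define I where "I = {u p - e <..< u p + e}"
  define K where "K = {y0 - e <..< y0 + e}"
  have box: "(t, y) \<in> V" if "t \<in> I" "y \<in> K" for t y
  proof -
    have "dist (u p, snd p) (t, y) \<le> \<bar>u p - t\<bar> + \<bar>y0 - y\<bar>"
      unfolding dist_Pair_Pair y0_def dist_real_def
      by (rule order_trans[OF sqrt_sum_squares_le_sum_abs]) simp
    also have "\<dots> < r" using that by (auto simp: I_def K_def e_def)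
    finally show ?thesis using r by auto
  qed
  have y0K: "y0 \<in> K" and upI: "u p \<in> I" using e by (auto simp: K_def I_def)
  define X where "X t y = fst (g (t, y))" for t y
  define M where "M t y = b (g (t, y)) / a (g (t, y))" for t y
  have gX: "g (t, y) = (X t y, y)" if "t \<in> I" "y \<in> K" for t y
    using inv[OF box[OF that]] by (simp add: X_def prod_eq_iff)
  have Xt: "((\<lambda>t. X t y) has_real_derivative 1 / a (g (t, y))) (at t)" if "t \<in> I" "y \<in> K" for t y
  proof -
    have 1: "((\<lambda>t. (t, y)) has_derivative (\<lambda>h. (h, 0))) (at t)"
      by (auto intro!: derivative_eq_intros)
    show ?thesis unfolding X_def has_field_derivative_def
      by (rule derivative_eq_intros has_derivative_compose[OF 1 der[OF box[OF that]]])+ auto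
  qed
  have Xy: "((\<lambda>y. X t y) has_real_derivative - M t y) (at y)" if "t \<in> I" "y \<in> K" for t y
  proof -
    have 1: "((\<lambda>y. (t, y)) has_derivative (\<lambda>h. (0, h))) (at y)"
      by (auto intro!: derivative_eq_intros)
    show ?thesis unfolding X_def M_def has_field_derivative_def
      by (rule derivative_eq_intros has_derivative_compose[OF 1 der[OF box[OF that]]])+ auto
  qed
  define W where "W t y = v (g (t, y))" for t y
  have Wt: "((\<lambda>t. W t y) has_real_derivative M t y) (at t)" if "t \<in> I" "y \<in> K" for t y
  proof -
    have 1: "((\<lambda>t. (t, y)) has_derivative (\<lambda>h. (h, 0))) (at t)"
      by (auto intro!: derivative_eq_intros)
    show ?thesis unfolding W_def M_def has_field_derivative_def
      by (rule has_derivative_eq_rhs[OF has_derivative_compose[OF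
            has_derivative_compose[OF 1 der[OF box[OF that]]] deriv_v]])
        (simp add: fun_eq_iff)
  qed
  have Wy: "((\<lambda>y. W t y) has_real_derivative 0) (at y)" if "t \<in> I" "y \<in> K" for t y
  proof -
    have 1: "((\<lambda>y. (t, y)) has_derivative (\<lambda>h. (0, h))) (at y)"
      by (auto intro!: derivative_eq_intros)
    show ?thesis unfolding W_def has_field_derivative_def
      using degenerate[of "g (t, y)"] inv[OF box[OF that]]
      by (intro has_derivative_eq_rhs[OF has_derivative_compose[OF
            has_derivative_compose[OF 1 der[OF box[OF that]]] deriv_v]])
        (simp add: fun_eq_iff field_simps power2_eq_square)
  qed
  have openI: "open I" and openK: "open K" and convK: "convex K"
    by (auto simp: I_def K_def)
  have W: "W t y = W t y0" if "t \<in> I" "y \<in> K" for t y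
    by (rule has_field_derivative_zero_constant[OF convK, of "W t", THEN exE])
      (use that y0K in \<open>auto intro: has_field_derivative_at_within Wy\<close>)
  have M: "M t y = M t y0" if "t \<in> I" "y \<in> K" for t y
  proof -
    have "((\<lambda>t. W t y) has_real_derivative M t y0) (at t)"
      by (rule has_field_derivative_transform_within_open[OF Wt[OF that(1) y0K] openI that(1)])
        (simp add: W that)
    then show ?thesis using Wt[OF that] DERIV_unique by blast
  qed
  have X: "X t y = X t y0 - M t y0 * (y - y0)" if "t \<in> I" "y \<in> K" for t y
  proof -
    have "((\<lambda>y. X t y + M t y0 * (y - y0)) has_real_derivative 0) (at y)" if "y \<in> K" for y
      using M[OF \<open>t \<in> I\<close> that] by (auto intro!: derivative_eq_intros Xy \<open>t \<in> I\<close> that)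
    then obtain k where "\<And>y. y \<in> K \<Longrightarrow> X t y + M t y0 * (y - y0) = k"
      using has_field_derivative_zero_constant[OF convK, of "\<lambda>y. X t y + M t y0 * (y - y0)"]
      by (auto intro: has_field_derivative_at_within)
    from this[OF that(2)] this[OF y0K] show ?thesis by simp
  qed
  \<comment> \<open>The second derivative of \<open>W\<close> is not known to exist. Expressing the slope by the values of \<open>X\<close>
    at two heights \<open>y0\<close> and \<open>y1\<close> allows the affine formula to be differentiated in \<open>t\<close> nevertheless.\<close>
  define y1 where "y1 = y0 + e / 2"
  have y1K: "y1 \<in> K" using e by (auto simp: K_def y1_def)
  define A where "A = 1 / a (g (u p, y0))"
  define B where "B = (1 / a (g (u p, y1)) - A) * (2 / e)"
  have A_affine: "1 / a (g (u p, y)) = A + B * (y - y0)" if "y \<in> K" for y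
  proof -
    have eq: "X t y0 + (X t y1 - X t y0) * (2 / e) * (y - y0) = X t y" if "t \<in> I" for t
    proof -
      have "(X t y1 - X t y0) * (2 / e) = - M t y0"
        using X[OF that y1K] e by (simp add: y1_def)
      then show ?thesis using X[OF that \<open>y \<in> K\<close>] by simp
    qed
    have D: "((\<lambda>t. X t y0 + (X t y1 - X t y0) * (2 / e) * (y - y0)) has_real_derivative
        A + B * (y - y0)) (at (u p))"
      unfolding A_def B_def
      by (intro DERIV_add DERIV_cmult_right DERIV_diff Xt upI y0K y1K)
    have "((\<lambda>t. X t y) has_real_derivative A + B * (y - y0)) (at (u p))"
      by (rule has_field_derivative_transform_within_open[OF D openI upI eq])
    then show ?thesis
      using Xt[OF upI that] DERIV_unique by blast
  qed
  have mM: "M (u p) y0 = m" and X0: "X (u p) y0 = fst p"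
    using V(3) by (auto simp: M_def m_def y0_def X_def)
  show thesis
  proof (rule that[of e A B])
    fix s :: real assume s: "\<bar>s\<bar> < e"
    then have K: "y0 + s \<in> K" by (auto simp: K_def)
    have "p + s *\<^sub>R (- m, 1) = g (u p, y0 + s)" (is "_ = ?q")
      using gX[OF upI K] X[OF upI K] mM X0 by (simp add: prod_eq_iff y0_def)
    moreover have "a ?q \<noteq> 0" using inv[OF box[OF upI K]] by simp
    moreover have "A + B * s = 1 / a ?q" using A_affine[OF K] by simp
    moreover have "b ?q / a ?q = m" using M[OF upI K] mM by (simp add: M_def)
    ultimately show "a (p + s *\<^sub>R (- m, 1)) * (A + B * s) = 1 \<and>
       b (p + s *\<^sub>R (- m, 1)) = m * a (p + s *\<^sub>R (- m, 1))"
      by auto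
  qed (use e in auto)
qed

text \<open>
  The local identities \<open>a (A + B s) = 1\<close> and \<open>b = m a\<close> propagate: the parameters where they hold
  form a closed set, in which \<open>a\<close> is nonzero because the product is 1. Thus at a limit of
  interior parameters the local statement applies again, and its affine function agrees with
  \<open>A + B s\<close> because the two coincide on an interval.
\<close>

lemma whole_line:
  assumes "a p \<noteq> 0"
  defines "m \<equiv> b p / a p"
  shows "a (p + s *\<^sub>R (- m, 1)) \<noteq> 0 \<and> b (p + s *\<^sub>R (- m, 1)) = m * a (p + s *\<^sub>R (- m, 1))"
proof -
  define l where "l s = p + s *\<^sub>R (- m, 1)" for s
  have l_add: "l (s + t) = l s + t *\<^sub>R (- m, 1)" for s t
    by (simp add: l_def algebra_simps)
  obtain \<delta> A B where \<delta>: "\<delta> > 0"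
    and AB: "\<And>s. \<bar>s\<bar> < \<delta> \<Longrightarrow> a (l s) * (A + B * s) = 1 \<and> b (l s) = m * a (l s)"
    using local_line[OF assms(1)] unfolding l_def m_def by metis
  define Q where "Q = {s. a (l s) * (A + B * s) = 1 \<and> b (l s) = m * a (l s)}"
  have cont: "continuous_on UNIV (\<lambda>s. a (l s))" "continuous_on UNIV (\<lambda>s. b (l s))"
    unfolding l_def
    by (intro continuous_on_compose2[OF cont_a] continuous_on_compose2[OF cont_b] continuous_intros; simp)+
  have "closed Q"
    unfolding Q_def by (intro closed_Collect_conj closed_Collect_eq continuous_intros cont)
  have "closure (interior Q) \<subseteq> interior Q"
  proof
    fix s assume s: "s \<in> closure (interior Q)"
    have "s \<in> Q"
      using s \<open>closed Q\<close> by (meson closure_minimal interior_subset subsetD)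
    then have as: "a (l s) \<noteq> 0" and ms: "b (l s) / a (l s) = m"
      by (auto simp: Q_def)
    obtain \<epsilon> A' B' where \<epsilon>: "\<epsilon> > 0"
      and AB': "\<And>t. \<bar>t\<bar> < \<epsilon> \<Longrightarrow> a (l (s + t)) * (A' + B' * t) = 1 \<and> b (l (s + t)) = m * a (l (s + t))"
      using local_line[OF as] unfolding l_add ms by metis
    obtain t where t: "t \<in> interior Q" "dist t s < \<epsilon>"
      using s \<epsilon> by (meson closure_approachable)
    have "open (interior Q \<inter> ball s \<epsilon>)" by (intro open_Int) auto
    moreover have "t \<in> interior Q \<inter> ball s \<epsilon>" using t by (simp add: dist_commute)
    ultimately obtain d where d: "d > 0" "ball t d \<subseteq> interior Q \<inter> ball s \<epsilon>"
      using open_contains_ball by blast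
    have eq: "A' + B' * (x - s) = A + B * x" if "x \<in> ball t d" for x
    proof -
      have "x \<in> Q" "\<bar>x - s\<bar> < \<epsilon>"
        using d that interior_subset[of Q] by (auto simp: dist_real_def)
      then show ?thesis using AB'[of "x - s"] by (auto simp: Q_def) (metis mult_cancel_left mult_zero_left zero_neq_one)
    qed
    have "A' + B' * (t - s) = A + B * t" "A' + B' * (t + d/2 - s) = A + B * (t + d/2)"
      by (intro eq; use d in \<open>simp add: dist_real_def\<close>)+
    then have "B' * (d/2) = B * (d/2)" by algebra
    then have "B' = B" using d by simp
    with \<open>A' + B' * (t - s) = A + B * t\<close> have "A' = A + B * s" by (simp add: algebra_simps)
    have "ball s \<epsilon> \<subseteq> Q"
    proof
      fix x assume "x \<in> ball s \<epsilon>"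
      then have "\<bar>x - s\<bar> < \<epsilon>" by (simp add: dist_real_def)
      from AB'[OF this] show "x \<in> Q"
        by (simp add: Q_def \<open>B' = B\<close> \<open>A' = A + B * s\<close> algebra_simps)
    qed
    then show "s \<in> interior Q"
      using \<epsilon> by (meson centre_in_ball interior_maximal open_ball subsetD)
  qed
  then have "closed (interior Q)"
    by (metis closure_subset closure_eq subset_antisym)
  moreover have "0 \<in> interior Q"
  proof -
    have "ball 0 \<delta> \<subseteq> Q" using AB by (auto simp: Q_def)
    then show ?thesis using \<delta> by (meson centre_in_ball interior_maximal open_ball subsetD)
  qed
  ultimately have "interior Q = UNIV"
    using clopen[of "interior Q"] by auto
  then have "s \<in> Q" using interior_subset by blast
  then show ?thesis by (auto simp: Q_def l_def)
qed

lemma kernel_line_if_a_nonzero: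
  assumes "a p \<noteq> 0" "in_kernel p w"
  shows "a (p + s *\<^sub>R w) \<noteq> 0 \<and> in_kernel (p + s *\<^sub>R w) w"
proof -
  define m where "m = b p / a p"
  have w: "fst w = - m * snd w"
  proof -
    have "a p * fst w = - (b p * snd w)"
      using assms(2) unfolding in_kernel_def by linarith
    then show ?thesis
      using assms(1) by (simp add: m_def field_simps)
  qed
  define q where "q = p + s *\<^sub>R w"
  have "q = p + (s * snd w) *\<^sub>R (- m, 1)"
    by (simp add: q_def prod_eq_iff w)
  then have q: "a q \<noteq> 0" "b q = m * a q"
    using whole_line[OF assms(1), of "s * snd w"] unfolding m_def by simp_all
  have 1: "a q * fst w + b q * snd w = 0"
    by (simp add: q w)
  have "a q * (b q * fst w + c q * snd w) = b q * (a q * fst w + b q * snd w)"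
    using degenerate[of q] by algebra
  with 1 q show ?thesis by (simp add: in_kernel_def q_def)
qed

text \<open>
  Exchanging the coordinates preserves the hypotheses and exchanges \<open>a\<close> with \<open>c\<close>. This covers the
  points where \<open>a\<close> vanishes but \<open>c\<close> does not.
\<close>

lemma swap: "degenerate_hessian (v \<circ> prod.swap) (u \<circ> prod.swap)
    (c \<circ> prod.swap) (b \<circ> prod.swap) (a \<circ> prod.swap)"
proof -
  have sw: "(prod.swap has_derivative prod.swap) (at z)" for z :: "real \<times> real"
    unfolding prod.swap_def by (auto intro!: derivative_eq_intros)
  have cs: "continuous_on UNIV (prod.swap :: real \<times> real \<Rightarrow> _)"
    by (rule continuous_on_swap)
  show ?thesis
  proof
    show "((v \<circ> prod.swap) has_derivative
        (\<lambda>w. (c \<circ> prod.swap) z * fst w + (b \<circ> prod.swap) z * snd w)) (at z)" for z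
      using has_derivative_compose[OF sw deriv_v, of z] by (simp add: o_def add.commute)
    show "((u \<circ> prod.swap) has_derivative
        (\<lambda>w. (b \<circ> prod.swap) z * fst w + (a \<circ> prod.swap) z * snd w)) (at z)" for z
      using has_derivative_compose[OF sw deriv_u, of z] by (simp add: o_def add.commute)
    show "(c \<circ> prod.swap) z * (a \<circ> prod.swap) z = ((b \<circ> prod.swap) z)\<^sup>2" for z
      using degenerate[of "prod.swap z"] by (simp add: mult.commute)
  qed (intro continuous_on_compose cs continuous_on_subset[OF cont_a subset_UNIV]
      continuous_on_subset[OF cont_b subset_UNIV] continuous_on_subset[OF cont_c subset_UNIV])+
qed

text \<open>
  The condition \<open>(a, c) \<noteq> (0, 0)\<close> says that the Hessian does not vanish, since \<open>b\<^sup>2 = a c\<close>.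
\<close>

lemma kernel_line:
  assumes "(a p, c p) \<noteq> (0, 0)" "in_kernel p w"
  shows "(a (p + s *\<^sub>R w), c (p + s *\<^sub>R w)) \<noteq> (0, 0) \<and> in_kernel (p + s *\<^sub>R w) w"
proof (cases "a p = 0")
  case False
  then show ?thesis using kernel_line_if_a_nonzero assms by simp
next
  case True
  interpret sw: degenerate_hessian "v \<circ> prod.swap" "u \<circ> prod.swap"
    "c \<circ> prod.swap" "b \<circ> prod.swap" "a \<circ> prod.swap" by (rule swap)
  have "prod.swap (prod.swap p + s *\<^sub>R prod.swap w) = p + s *\<^sub>R w"
    by (simp add: prod_eq_iff)
  then show ?thesis
    using sw.kernel_line_if_a_nonzero[of "prod.swap p" "prod.swap w" s] assms True
    by (auto simp: in_kernel_def sw.in_kernel_def add.commute)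
qed

lemma in_kernel_scale: "in_kernel z w \<Longrightarrow> in_kernel z (r *\<^sub>R w)"
proof -
  assume "in_kernel z w"
  moreover have "a z * fst (r *\<^sub>R w) + b z * snd (r *\<^sub>R w) = r * (a z * fst w + b z * snd w)"
    "b z * fst (r *\<^sub>R w) + c z * snd (r *\<^sub>R w) = r * (b z * fst w + c z * snd w)"
    by (simp_all add: algebra_simps)
  ultimately show ?thesis unfolding in_kernel_def by simp
qed

text \<open>
  The lines of \<open>kernel_line\<close> through two points with nonvanishing Hessian have the same direction,
  for otherwise they cross. At the other points every direction is in the kernel.
\<close>

lemma common_kernel:
  obtains w where "w \<noteq> 0" "\<And>z. in_kernel z w"
proof (cases "\<exists>p. (a p, c p) \<noteq> (0, 0)")
  case False
  then have ac: "a z = 0" "c z = 0" for z by blast+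
  then have "b z = 0" for z using degenerate[of z] by simp
  with ac that[of "(1, 0)"] show ?thesis by (simp add: in_kernel_def zero_prod_def)
next
  case True
  have ex: "\<exists>w. w \<noteq> 0 \<and> in_kernel z w" if "(a z, c z) \<noteq> (0, 0)" for z
  proof (cases "a z = 0")
    case True
    then show ?thesis using that degenerate[of z]
      by (intro exI[of _ "(1, 0)"]) (auto simp: in_kernel_def zero_prod_def)
  next
    case False
    then show ?thesis using degenerate[of z]
      by (intro exI[of _ "(- b z, a z)"]) (auto simp: in_kernel_def zero_prod_def algebra_simps power2_eq_square)
  qed
  obtain p w where p: "(a p, c p) \<noteq> (0, 0)" and w: "w \<noteq> 0" "in_kernel p w"
    using True ex by blast
  have "in_kernel z w" for z
  proof (cases "(a z, c z) = (0, 0)")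
    case True
    then show ?thesis using degenerate[of z] by (auto simp: in_kernel_def)
  next
    case False
    then obtain w' where w': "w' \<noteq> 0" "in_kernel z w'" using ex by blast
    define \<Delta> where "\<Delta> = fst w * snd w' - snd w * fst w'"
    have "\<Delta> = 0"
    proof (rule ccontr)
      assume \<Delta>: "\<Delta> \<noteq> 0"
      \<comment> \<open>Cramer's rule for the crossing point \<open>p + s w = z + t w'\<close>.\<close>
      define s where "s = ((fst z - fst p) * snd w' - (snd z - snd p) * fst w') / \<Delta>"
      define t where "t = ((fst z - fst p) * snd w - (snd z - snd p) * fst w) / \<Delta>"
      define q where "q = p + s *\<^sub>R w"
      have s: "s * \<Delta> = (fst z - fst p) * snd w' - (snd z - snd p) * fst w'"
        and t: "t * \<Delta> = (fst z - fst p) * snd w - (snd z - snd p) * fst w"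
        using \<Delta> by (simp_all add: s_def t_def)
      have "\<Delta> * (fst p + s * fst w) = \<Delta> * (fst z + t * fst w')"
        "\<Delta> * (snd p + s * snd w) = \<Delta> * (snd z + t * snd w')"
        using s t unfolding \<Delta>_def by algebra+
      then have "q = z + t *\<^sub>R w'" using \<Delta> by (simp add: q_def prod_eq_iff)
      then have q: "(a q, c q) \<noteq> (0, 0)" "in_kernel q w" "in_kernel q w'"
        using kernel_line[OF p w(2), of s] kernel_line[OF False w'(2), of t]
        by (simp_all add: q_def)
      from q(2,3) have "\<Delta> * a q = 0" "\<Delta> * c q = 0"
        unfolding in_kernel_def \<Delta>_def by algebra+
      with \<Delta> q show False by simp
    qed
    then have "\<exists>r. w = r *\<^sub>R w'"
    proof (cases "fst w' = 0")
      case True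
      then have "snd w' \<noteq> 0" using w' by (auto simp: prod_eq_iff)
      with True \<open>\<Delta> = 0\<close> show ?thesis
        by (intro exI[of _ "snd w / snd w'"]) (auto simp: prod_eq_iff \<Delta>_def)
    next
      case False
      with \<open>\<Delta> = 0\<close> show ?thesis
        by (intro exI[of _ "fst w / fst w'"]) (auto simp: prod_eq_iff \<Delta>_def field_simps)
    qed
    then show ?thesis using in_kernel_scale w' by blast
  qed
  with w that show ?thesis by blast
qed

text \<open>
  Being in the kernel gives invariance along \<open>w\<close>. Since the Hessian is symmetric, its image is
  orthogonal to its kernel, so the component of the gradient along \<open>w\<close> is constant.
\<close>

theorem cylinder:
  obtains w k where "w \<noteq> 0"
    "\<And>z s. u (z + s *\<^sub>R w) = u z \<and> v (z + s *\<^sub>R w) = v z"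
    "\<And>z. fst w * u z + snd w * v z = k"
proof -
  obtain w where w: "w \<noteq> 0" and ker: "\<And>z. in_kernel z w"
    using common_kernel by blast
  have line: "((\<lambda>s. z + s *\<^sub>R w) has_derivative (\<lambda>h. h *\<^sub>R w)) (at s)" for z s
    by (auto intro!: derivative_eq_intros)
  have "u (z + s *\<^sub>R w) = u z \<and> v (z + s *\<^sub>R w) = v z" for z s
  proof -
    let ?q = "\<lambda>s. z + s *\<^sub>R w"
    have ker': "h * (a q * fst w) + h * (b q * snd w) = 0" "h * (b q * fst w) + h * (c q * snd w) = 0"
      for q h
      using ker[of q] by (simp_all add: in_kernel_def flip: distrib_left)
    have "((\<lambda>s. u (?q s)) has_derivative (\<lambda>h. 0)) (at s)"
         "((\<lambda>s. v (?q s)) has_derivative (\<lambda>h. 0)) (at s)" for s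
      using has_derivative_compose[OF line[of z s] deriv_u] has_derivative_compose[OF line[of z s] deriv_v]
      by (simp_all add: mult.left_commute ker')
    then obtain k1 k2 where "\<And>s. u (?q s) = k1" "\<And>s. v (?q s) = k2"
      using has_derivative_zero_constant[OF convex_UNIV, of "\<lambda>s. u (?q s)"]
        has_derivative_zero_constant[OF convex_UNIV, of "\<lambda>s. v (?q s)"] by auto
    from this(1)[of 0] this(1)[of s] this(2)[of 0] this(2)[of s] show ?thesis by simp
  qed
  moreover have "((\<lambda>z. fst w * u z + snd w * v z) has_derivative (\<lambda>h. 0)) (at z)" for z
  proof -
    have "fst w * (a z * fst h + b z * snd h) + snd w * (b z * fst h + c z * snd h) = 0" for h
      using ker[of z] unfolding in_kernel_def by algebra
    then show ?thesis by (auto intro!: derivative_eq_intros deriv_u deriv_v)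
  qed
  then obtain k where "\<And>z. fst w * u z + snd w * v z = k"
    using has_derivative_zero_constant[OF convex_UNIV, of "\<lambda>z. fst w * u z + snd w * v z"] by auto
  ultimately show thesis using w that by blast
qed

end

section \<open>Unipotent maps as shears\<close>

lemma singular_imp_eigenvalue:
  fixes M :: "complex ^ 2 ^ 2"
  assumes "(M $ 1 $ 1 - c) * (M $ 2 $ 2 - c) = M $ 1 $ 2 * M $ 2 $ 1"
  shows "c \<in> eigenvalues M"
proof -
  have "\<exists>x y. (x \<noteq> 0 \<or> y \<noteq> 0) \<and> M $ 1 $ 1 * x + M $ 1 $ 2 * y = c * x \<and>
      M $ 2 $ 1 * x + M $ 2 $ 2 * y = c * y"
  proof (cases "M $ 1 $ 2 = 0 \<and> M $ 1 $ 1 = c")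
    case False
    have "M $ 2 $ 1 * M $ 1 $ 2 + M $ 2 $ 2 * (c - M $ 1 $ 1) = c * (c - M $ 1 $ 1)"
      using assms by algebra
    with False show ?thesis
      by (intro exI[of _ "M $ 1 $ 2"] exI[of _ "c - M $ 1 $ 1"]) (auto simp: algebra_simps)
  next
    case True
    show ?thesis
    proof (cases "M $ 2 $ 2 = c \<and> M $ 2 $ 1 = 0")
      case False
      with True show ?thesis
        by (intro exI[of _ "M $ 2 $ 2 - c"] exI[of _ "- (M $ 2 $ 1)"]) (auto simp: algebra_simps)
    qed (use True in auto)
  qed
  then obtain x y where xy: "x \<noteq> 0 \<or> y \<noteq> 0" "M $ 1 $ 1 * x + M $ 1 $ 2 * y = c * x"
      "M $ 2 $ 1 * x + M $ 2 $ 2 * y = c * y" by blast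
  then have "vector [x, y] \<noteq> (0 :: complex ^ 2)" "M *v vector [x, y] = c *s vector [x, y]"
    by (auto simp: vec_eq_iff forall_2 matrix_vector_mult_def sum_2)
  then show ?thesis unfolding eigenvalues_def by blast
qed

text \<open>
  Both complex roots of the characteristic polynomial are eigenvalues, hence equal to 1, and the
  polynomial is \<open>(t - 1)\<^sup>2\<close>.
\<close>

lemma trace_det_of_unipotent:
  fixes A :: "real ^ 2 ^ 2"
  assumes "eigenvalues (map_matrix complex_of_real A) \<subseteq> {1}"
  shows "A $ 1 $ 1 + A $ 2 $ 2 = 2" "A $ 1 $ 1 * A $ 2 $ 2 - A $ 1 $ 2 * A $ 2 $ 1 = 1"
proof -
  define T where "T = complex_of_real (A $ 1 $ 1 + A $ 2 $ 2)"
  define D where "D = complex_of_real (A $ 1 $ 1 * A $ 2 $ 2 - A $ 1 $ 2 * A $ 2 $ 1)"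
  have root: "c = 1" if "c * c - T * c + D = 0" for c
  proof -
    have "c \<in> eigenvalues (map_matrix complex_of_real A)"
      using that by (intro singular_imp_eigenvalue) (simp add: T_def D_def map_matrix_def algebra_simps)
    then show ?thesis using assms by blast
  qed
  define s where "s = csqrt (T\<^sup>2 - 4 * D)"
  have s: "s\<^sup>2 = T\<^sup>2 - 4 * D" by (simp add: s_def)
  have roots: "((T + s) / 2) * ((T + s) / 2) - T * ((T + s) / 2) + D = (s\<^sup>2 - (T\<^sup>2 - 4 * D)) / 4"
    "((T - s) / 2) * ((T - s) / 2) - T * ((T - s) / 2) + D = (s\<^sup>2 - (T\<^sup>2 - 4 * D)) / 4"
    by (simp_all add: field_simps power2_eq_square)
  have "(T + s) / 2 = 1" "(T - s) / 2 = 1"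
    by (rule root, unfold roots, simp add: s)+
  then have "T + s = 2" "T - s = 2" by simp_all
  moreover have "T = ((T + s) + (T - s)) / 2" by simp
  ultimately have "T = 2" by simp
  have "s = 0" using \<open>T + s = 2\<close> \<open>T = 2\<close> by simp
  with s \<open>T = 2\<close> have "D = 1" by simp
  have "complex_of_real (A $ 1 $ 1 + A $ 2 $ 2) = complex_of_real 2"
    "complex_of_real (A $ 1 $ 1 * A $ 2 $ 2 - A $ 1 $ 2 * A $ 2 $ 1) = complex_of_real 1"
    using \<open>T = 2\<close> \<open>D = 1\<close> by (simp_all add: T_def D_def)
  then show "A $ 1 $ 1 + A $ 2 $ 2 = 2" "A $ 1 $ 1 * A $ 2 $ 2 - A $ 1 $ 2 * A $ 2 $ 1 = 1"
    by (simp_all only: of_real_eq_iff)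
qed

text \<open>
  The cylinder theorem applied to \<open>(- H\<^sub>2, H\<^sub>1)\<close> with \<open>H = G - id\<close>. The quarter turn between \<open>H\<close> and
  this gradient converts the constant component along \<open>d\<close> into a constant component of \<open>H\<close>
  transversal to \<open>d\<close>.
\<close>

theorem unipotent_imp_shear:
  fixes G :: "real ^ 2 \<Rightarrow> real ^ 2"
  assumes "unipotent G" and "C1_map G"
  obtains d k where "d \<noteq> 0" "\<And>z s. G (z + s *\<^sub>R d) = G z + s *\<^sub>R d"
    "\<And>z. d $ 1 * (G z - z) $ 2 - d $ 2 * (G z - z) $ 1 = k"
proof -
  define J where "J z = jacobian G (at z)" for z
  have der: "(G has_derivative (\<lambda>h. J z *v h)) (at z)" for z
    using assms(2) jacobian_works unfolding C1_map_def J_def by blast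
  have contJ: "continuous_on UNIV J"
    using assms(2) by (simp add: C1_map_def J_def[abs_def])
  have "eigenvalues (map_matrix complex_of_real (J z)) \<subseteq> {1}" for z
    using assms(1) unfolding unipotent_def Spc_def J_def by blast
  note TD = trace_det_of_unipotent[OF this]
  define e :: "real \<times> real \<Rightarrow> real ^ 2" where "e = (\<lambda>x. vector [fst x, snd x])"
  have e_nth [simp]: "e x $ 1 = fst x" "e x $ 2 = snd x" for x
    by (simp_all add: e_def)
  have e_alt: "e = (\<lambda>x. fst x *\<^sub>R axis 1 1 + snd x *\<^sub>R axis 2 1)"
    by (rule ext) (simp add: vec_eq_iff forall_2 axis_def)
  have e_der: "(e has_derivative e) (at x)" for x
    unfolding e_alt by (auto intro!: derivative_eq_intros)
  have e_cont: "continuous_on UNIV e"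
    unfolding e_alt by (intro continuous_intros)
  have G_der: "((\<lambda>x. G (e x) $ i) has_derivative (\<lambda>h. J (e x) $ i $ 1 * fst h + J (e x) $ i $ 2 * snd h)) (at x)" for x i
    using has_derivative_compose[OF has_derivative_compose[OF e_der der]
        bounded_linear_imp_has_derivative[OF bounded_linear_vec_nth]]
    by (simp add: matrix_vector_mult_def sum_2)
  have J_cont: "continuous_on UNIV (\<lambda>x. J (e x) $ i $ j)" for i j
    by (intro continuous_on_component continuous_on_compose2[OF contJ e_cont]) simp
  interpret degenerate_hessian "\<lambda>x. snd x - G (e x) $ 2" "\<lambda>x. G (e x) $ 1 - fst x"
    "\<lambda>x. - (J (e x) $ 2 $ 1)" "\<lambda>x. J (e x) $ 1 $ 1 - 1" "\<lambda>x. J (e x) $ 1 $ 2"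
  proof
    fix x
    have 22: "J (e x) $ 2 $ 2 = 2 - J (e x) $ 1 $ 1" using TD(1)[of "e x"] by simp
    show "((\<lambda>x. snd x - G (e x) $ 2) has_derivative
        (\<lambda>h. - (J (e x) $ 2 $ 1) * fst h + (J (e x) $ 1 $ 1 - 1) * snd h)) (at x)"
      by (rule derivative_eq_intros G_der refl)+ (auto simp: 22 algebra_simps)
    show "((\<lambda>x. G (e x) $ 1 - fst x) has_derivative
        (\<lambda>h. (J (e x) $ 1 $ 1 - 1) * fst h + J (e x) $ 1 $ 2 * snd h)) (at x)"
      by (rule derivative_eq_intros G_der refl)+ (auto simp: algebra_simps)
    show "- (J (e x) $ 2 $ 1) * J (e x) $ 1 $ 2 = (J (e x) $ 1 $ 1 - 1)\<^sup>2"
      using TD(2)[of "e x"] unfolding 22 by algebra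
  qed (intro continuous_intros J_cont)+
  obtain w k where w: "w \<noteq> 0"
    and inv: "\<And>x s. snd (x + s *\<^sub>R w) - G (e (x + s *\<^sub>R w)) $ 2 = snd x - G (e x) $ 2 \<and>
      G (e (x + s *\<^sub>R w)) $ 1 - fst (x + s *\<^sub>R w) = G (e x) $ 1 - fst x"
    and k: "\<And>x. fst w * (snd x - G (e x) $ 2) + snd w * (G (e x) $ 1 - fst x) = k"
    by (rule cylinder, rule that; blast)
  have surj: "z = e (z $ 1, z $ 2)" for z
    by (simp add: vec_eq_iff forall_2)
  show thesis
  proof (rule that[of "e w" "- k"])
    show "e w \<noteq> 0" using w by (auto simp: vec_eq_iff forall_2 prod_eq_iff)
    show "G (z + s *\<^sub>R e w) = G z + s *\<^sub>R e w" for z s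
    proof -
      let ?x = "(z $ 1, z $ 2)"
      have "e (?x + s *\<^sub>R w) = z + s *\<^sub>R e w" "e ?x = z"
        by (simp_all add: vec_eq_iff forall_2)
      with inv[of ?x s] show ?thesis by (simp add: vec_eq_iff forall_2)
    qed
    show "e w $ 1 * (G z - z) $ 2 - e w $ 2 * (G z - z) $ 1 = - k" for z
      using k[of "(z $ 1, z $ 2)"] by (simp flip: surj add: algebra_simps)
  qed
qed

section \<open>Dynamics of shears\<close>

text \<open>
  The linear form \<open>l\<close> with kernel spanned by \<open>d\<close> turns \<open>G\<close> into the translation by \<open>k\<close>. If \<open>k = 0\<close>,
  then \<open>G\<close> acts on each line in direction \<open>d\<close> as a translation.
\<close>

lemma shear_no_periodic_point:
  fixes G :: "real ^ 2 \<Rightarrow> real ^ 2"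
  assumes "d \<noteq> 0" and inv: "\<And>z s. G (z + s *\<^sub>R d) = G z + s *\<^sub>R d"
    and k: "\<And>z. d $ 1 * (G z - z) $ 2 - d $ 2 * (G z - z) $ 1 = k"
  shows "\<not> periodic_point G z"
proof
  assume "periodic_point G z"
  then obtain p where p: "p > 1" "(G ^^ p) z = z" "\<And>m. m \<in> {1..p - 1} \<Longrightarrow> (G ^^ m) z \<noteq> z"
    unfolding periodic_point_def by blast
  have "G z \<noteq> z" using p(3)[of 1] p(1) by simp
  define l where "l y = d $ 1 * y $ 2 - d $ 2 * y $ 1" for y :: "real ^ 2"
  have l: "l (G y) = l y + k" for y
    using k[of y] by (simp add: l_def algebra_simps)
  have "l ((G ^^ n) z) = l z + real n * k" for n
    by (induction n) (simp_all add: l algebra_simps)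
  from this[of p] p have "k = 0" by simp
  have "\<exists>r. G z - z = r *\<^sub>R d"
  proof (cases "d $ 1 = 0")
    case True
    then have "d $ 2 \<noteq> 0" using assms(1) by (auto simp: vec_eq_iff forall_2)
    with True k[of z] \<open>k = 0\<close> show ?thesis
      by (intro exI[of _ "(G z - z) $ 2 / d $ 2"]) (auto simp: vec_eq_iff forall_2)
  next
    case False
    with k[of z] \<open>k = 0\<close> show ?thesis
      by (intro exI[of _ "(G z - z) $ 1 / d $ 1"]) (auto simp: vec_eq_iff forall_2 field_simps)
  qed
  then obtain r where r: "G z = z + r *\<^sub>R d" by (metis diff_add_cancel add.commute)
  have "(G ^^ n) z = z + (real n * r) *\<^sub>R d" for n
    by (induction n) (simp_all add: inv r algebra_simps)
  from this[of p] p assms(1) have "r = 0" by simp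
  with r \<open>G z \<noteq> z\<close> show False by simp
qed

theorem theorem4p9:
  fixes G :: "real ^ 2 \<Rightarrow> real ^ 2"
  assumes "unipotent G"
    and "C1_map G"
  shows "\<nexists>z. periodic_point G z"
proof -
  obtain d k where "d \<noteq> 0" "\<And>z s. G (z + s *\<^sub>R d) = G z + s *\<^sub>R d"
    "\<And>z. d $ 1 * (G z - z) $ 2 - d $ 2 * (G z - z) $ 1 = k"
    using unipotent_imp_shear[OF assms] by metis
  then show ?thesis using shear_no_periodic_point by metis
qed

end
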